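(* Let $G$ be a finite, simple, connected, undirected graph and $N\ge2$. Then (1) for $K\le N-1$: $c(G)=K$ if and only if $\max_{s\in S_{nc}}c_N(G|s)=K$; (2) $c(G)>N-1$ if and only if $\max_{s\in S_{nc}}c_N(G|s)=\infty$.
   Context: $c(G)$ is the classical cop number of $G$: the minimum number of cops needed to guarantee capture of the robber in the classical cops and robber game from any starting position. The CR-pregame $\breve\Gamma_N(G)$: there are $N$ tokens, cops $C_1,\dots,C_{N-1}$ (tokens $1,\dots,N-1$) and robber $R$ (token $N$), with no payoffs specified. A state is $s=(x^1,\dots,x^N,n)$ with $x^i\in V$ the position of token $i$ and $n$ the token to move; $s$ is a capture state if $x^i=x^N$ for some $i\le N-1$, and $S_{nc}$ is the set of noncapture states. In each turn the token to move moves to a vertex of its closed neighbourhood (may stay put); order $C_1,\dots,C_{N-1},R,C_1,\dots$. For $s\in S_{nc}$ the state cop number $c_N(G|s)$ is the minimum $k\in\{1,\dots,N-1\}$ for which there exist $k$ cops and strategies for them such that, starting from $s$, a capture (by any cop, not necessarily one of these $k$) occurs whatever the other $N-k$ tokens (including $R$) do; $c_N(G|s)=\infty$ if no such $k$ exists. *)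

theory Defs
  imports Main "HOL-Library.Extended_Nat"
begin

definition fsc_graph :: "'a set \<Rightarrow> ('a \<Rightarrow> 'a \<Rightarrow> bool) \<Rightarrow> bool" where
  "fsc_graph V E \<longleftrightarrow> finite V \<and> V \<noteq> {}
     \<and> (\<forall>u v. E u v \<longrightarrow> u \<in> V \<and> v \<in> V)
     \<and> (\<forall>u v. E u v \<longrightarrow> E v u)
     \<and> (\<forall>u. \<not> E u u)
     \<and> (\<forall>u\<in>V. \<forall>v\<in>V. E\<^sup>*\<^sup>* u v)"

definition cnbhd :: "('a \<Rightarrow> 'a \<Rightarrow> bool) \<Rightarrow> 'a \<Rightarrow> 'a set" where
  "cnbhd E v = insert v {u. E v u}"

text \<open>State: (cop positions, robber position, True iff it is the cops' turn).
  In a cops' turn all cops move simultaneously; then the robber moves.\<close>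

type_synonym 'a cstate = "'a list \<times> 'a \<times> bool"

definition classical_legal_strategy ::
  "('a \<Rightarrow> 'a \<Rightarrow> bool) \<Rightarrow> ('a cstate list \<Rightarrow> 'a list) \<Rightarrow> bool" where
  "classical_legal_strategy E \<sigma> \<longleftrightarrow>
     (\<forall>h. h \<noteq> [] \<longrightarrow> snd (snd (last h)) \<longrightarrow>
        length (\<sigma> h) = length (fst (last h)) \<and>
        (\<forall>j < length (fst (last h)). \<sigma> h ! j \<in> cnbhd E (fst (last h) ! j)))"

definition classical_play ::
  "('a \<Rightarrow> 'a \<Rightarrow> bool) \<Rightarrow> ('a cstate list \<Rightarrow> 'a list) \<Rightarrow> 'a cstate \<Rightarrow> (nat \<Rightarrow> 'a cstate) \<Rightarrow> bool" where
  "classical_play E \<sigma> s0 p \<longleftrightarrow> p 0 = s0 \<and>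
     (\<forall>t. (case p t of (cs, r, b) \<Rightarrow>
        (if b then p (Suc t) = (\<sigma> (map p [0..<Suc t]), r, False)
         else (\<exists>r' \<in> cnbhd E r. p (Suc t) = (cs, r', True)))))"

definition classical_capture :: "'a cstate \<Rightarrow> bool" where
  "classical_capture s \<longleftrightarrow> fst (snd s) \<in> set (fst s)"

definition classical_cops_win :: "'a set \<Rightarrow> ('a \<Rightarrow> 'a \<Rightarrow> bool) \<Rightarrow> nat \<Rightarrow> bool" where
  "classical_cops_win V E k \<longleftrightarrow>
     (\<forall>cs r. length cs = k \<and> set cs \<subseteq> V \<and> r \<in> V \<longrightarrow>
        (\<exists>\<sigma>. classical_legal_strategy E \<sigma> \<and>
           (\<forall>p. classical_play E \<sigma> (cs, r, True) p \<longrightarrow> (\<exists>t. classical_capture (p t)))))"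

definition cop_number :: "'a set \<Rightarrow> ('a \<Rightarrow> 'a \<Rightarrow> bool) \<Rightarrow> nat" where
  "cop_number V E = (LEAST k. classical_cops_win V E k)"

text \<open>State (xs, n): xs ! (i - 1) is the position of token i (1 \<le> i \<le> N),
  tokens 1..N-1 are the cops, token N is the robber, n is the token to move.\<close>

type_synonym 'a pstate = "'a list \<times> nat"

definition next_token :: "nat \<Rightarrow> nat \<Rightarrow> nat" where
  "next_token N n = (if n < N then n + 1 else 1)"

definition pos :: "'a pstate \<Rightarrow> nat \<Rightarrow> 'a" where
  "pos s i = fst s ! (i - 1)"

definition is_capture :: "nat \<Rightarrow> 'a pstate \<Rightarrow> bool" where
  "is_capture N s \<longleftrightarrow> (\<exists>i \<in> {1..N-1}. pos s i = pos s N)"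

definition S_nc :: "'a set \<Rightarrow> nat \<Rightarrow> 'a pstate set" where
  "S_nc V N = {s. length (fst s) = N \<and> set (fst s) \<subseteq> V \<and> snd s \<in> {1..N}
                  \<and> \<not> is_capture N s}"

definition pregame_legal_strategy ::
  "('a \<Rightarrow> 'a \<Rightarrow> bool) \<Rightarrow> nat set \<Rightarrow> (nat \<Rightarrow> 'a pstate list \<Rightarrow> 'a) \<Rightarrow> bool" where
  "pregame_legal_strategy E C \<sigma> \<longleftrightarrow>
     (\<forall>i\<in>C. \<forall>h. h \<noteq> [] \<longrightarrow> snd (last h) = i \<longrightarrow> \<sigma> i h \<in> cnbhd E (pos (last h) i))"

definition pregame_play ::
  "('a \<Rightarrow> 'a \<Rightarrow> bool) \<Rightarrow> nat \<Rightarrow> nat set \<Rightarrow> (nat \<Rightarrow> 'a pstate list \<Rightarrow> 'a)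
     \<Rightarrow> 'a pstate \<Rightarrow> (nat \<Rightarrow> 'a pstate) \<Rightarrow> bool" where
  "pregame_play E N C \<sigma> s p \<longleftrightarrow> p 0 = s \<and>
     (\<forall>t. (case p t of (xs, n) \<Rightarrow>
        (if n \<in> C then p (Suc t) = (xs[n - 1 := \<sigma> n (map p [0..<Suc t])], next_token N n)
         else (\<exists>y \<in> cnbhd E (xs ! (n - 1)).
                 p (Suc t) = (xs[n - 1 := y], next_token N n)))))"

definition k_cops_capture ::
  "('a \<Rightarrow> 'a \<Rightarrow> bool) \<Rightarrow> nat \<Rightarrow> 'a pstate \<Rightarrow> nat \<Rightarrow> bool" where
  "k_cops_capture E N s k \<longleftrightarrow>
     (\<exists>C \<sigma>. C \<subseteq> {1..N-1} \<and> card C = k \<and> pregame_legal_strategy E C \<sigma> \<and>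
        (\<forall>p. pregame_play E N C \<sigma> s p \<longrightarrow> (\<exists>t. is_capture N (p t))))"

definition state_cop_number ::
  "('a \<Rightarrow> 'a \<Rightarrow> bool) \<Rightarrow> nat \<Rightarrow> 'a pstate \<Rightarrow> enat" where
  "state_cop_number E N s =
     (if \<exists>k \<in> {1..N-1}. k_cops_capture E N s k
      then enat (LEAST k. k \<in> {1..N-1} \<and> k_cops_capture E N s k)
      else \<infinity>)"

end

theory Submission
  imports Defs
begin

text \<open>Both games are reachability games, in which a winning strategy exists precisely from the
  states of the inductively defined attractor of the capture states.

  If \<open>k\<close> cops win the classical game, tokens \<open>1, \<dots>, k\<close> win the pregame from every state: they wait
  for the turn of token 1 and then play the classical strategy, one token after the other.

  Suppose conversely that \<open>m \<ge> 1\<close> cops do not win the classical game. As cops can walk to any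
  prescribed placement, for each vertex \<open>v\<close> there is a robber vertex \<open>r\<close> from which \<open>m\<close> cops
  starting at \<open>v\<close> lose. Put all \<open>N - 1\<close> cop tokens on \<open>v\<close> and the robber on \<open>r\<close>. Given a nonempty
  set \<open>C\<close> of at most \<open>m\<close> cops, the robber plays the classical evasion against \<open>C\<close>, while
  every other cop follows a fixed member of \<open>C\<close> one round behind. A robber who is safe when the cops
  are to move is not in the closed neighbourhood of a cop of \<open>C\<close>, so the followers do not
  capture him either.\<close>

section \<open>Reachability games\<close>

text \<open>The states from which the owner of the \<open>mine\<close> states can force
  \<open>target\<close>. As an inductive predicate it mentions neither strategies nor infinite
  plays, so winning becomes accessible to rule induction. An opponent's state without moves would
  count as won; both games below always offer a move.\<close>

inductive attractor ::
  "('s \<Rightarrow> bool) \<Rightarrow> ('s \<Rightarrow> 's \<Rightarrow> bool) \<Rightarrow> ('s \<Rightarrow> bool) \<Rightarrow> 's \<Rightarrow> bool"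
  for mine move target where
  target: "target s \<Longrightarrow> attractor mine move target s"
| mine: "mine s \<Longrightarrow> move s s' \<Longrightarrow> attractor mine move target s' \<Longrightarrow> attractor mine move target s"
| other: "\<not> mine s \<Longrightarrow> (\<And>s'. move s s' \<Longrightarrow> attractor mine move target s')
    \<Longrightarrow> attractor mine move target s"

definition legal_strategy ::
  "('s \<Rightarrow> bool) \<Rightarrow> ('s \<Rightarrow> 's \<Rightarrow> bool) \<Rightarrow> ('s list \<Rightarrow> 's) \<Rightarrow> bool" where
  "legal_strategy mine move \<tau> \<longleftrightarrow> (\<forall>h. h \<noteq> [] \<longrightarrow> mine (last h) \<longrightarrow> move (last h) (\<tau> h))"

definition game_play ::
  "('s \<Rightarrow> bool) \<Rightarrow> ('s \<Rightarrow> 's \<Rightarrow> bool) \<Rightarrow> ('s list \<Rightarrow> 's) \<Rightarrow> 's \<Rightarrow> (nat \<Rightarrow> 's) \<Rightarrow> bool" where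
  "game_play mine move \<tau> s p \<longleftrightarrow> p 0 = s \<and>
     (\<forall>t. if mine (p t) then p (Suc t) = \<tau> (map p [0..<Suc t]) else move (p t) (p (Suc t)))"

lemma map_upt_Suc_shift: "map p [0..<Suc (Suc t)] = p 0 # map (\<lambda>i. p (Suc i)) [0..<Suc t]"
  by (simp add: upt_conv_Cons map_Suc_upt[symmetric] o_def del: upt_Suc)

text \<open>Lets the induction hypothesis for a successor be applied to the rest of a play.
  Agreement of the strategies is asked only for histories beginning in \<open>p 1\<close>, since a
  glued strategy may branch on that state.\<close>

lemma game_play_shift:
  assumes "game_play mine move \<tau> s p"
    and "\<And>h. h \<noteq> [] \<Longrightarrow> hd h = p 1 \<Longrightarrow> \<tau> (s # h) = \<tau>' h"
  shows "game_play mine move \<tau>' (p 1) (\<lambda>i. p (Suc i))"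
  unfolding game_play_def
proof (intro conjI allI)
  fix t
  let ?h = "map (\<lambda>i. p (Suc i)) [0..<Suc t]"
  have p: "p 0 = s"
    "if mine (p (Suc t)) then p (Suc (Suc t)) = \<tau> (map p [0..<Suc (Suc t)])
     else move (p (Suc t)) (p (Suc (Suc t)))"
    using assms(1) unfolding game_play_def by blast+
  have "?h \<noteq> []" "hd ?h = p 1"
    by (simp_all add: hd_map upt_conv_Cons del: upt_Suc)
  then have "\<tau> (map p [0..<Suc (Suc t)]) = \<tau>' ?h"
    using assms(2) p(1) map_upt_Suc_shift by metis
  with p(2) show "if mine (p (Suc t)) then p (Suc (Suc t)) = \<tau>' ?h
     else move (p (Suc t)) (p (Suc (Suc t)))"
    by metis
qed simp

text \<open>The first move follows the attractor rule; afterwards the initial state is dropped from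
  the history and the successor's strategy takes over. Totality supplies default moves, because
  legality is demanded even on histories that never arise.\<close>

lemma attractor_imp_strategy:
  assumes "attractor mine move target s" and total: "\<And>s. \<exists>s'. move s s'"
  shows "\<exists>\<tau>. legal_strategy mine move \<tau> \<and>
    (\<forall>p. game_play mine move \<tau> s p \<longrightarrow> (\<exists>t. target (p t)))"
  using assms(1)
proof induction
  case (target s)
  obtain f where "\<And>s. move s (f s)"
    using total by metis
  then show ?case
    using target by (intro exI[of _ "\<lambda>h. f (last h)"]) (auto simp: legal_strategy_def game_play_def)
next
  case (mine s s')
  obtain f where f: "\<And>s. move s (f s)"
    using total by metis
  obtain \<tau>' where \<tau>': "legal_strategy mine move \<tau>'"
    "\<And>p. game_play mine move \<tau>' s' p \<Longrightarrow> \<exists>t. target (p t)"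
    using mine by blast
  \<comment> \<open>\<open>tl h = []\<close> singles out the first move; \<open>f\<close> is the
    default on one-state histories other than \<open>[s]\<close>.\<close>
  define \<tau> where
    "\<tau> h = (if tl h = [] then (if last h = s then s' else f (last h)) else \<tau>' (tl h))" for h
  have "legal_strategy mine move \<tau>"
    using \<tau>'(1) f mine.hyps by (auto simp: legal_strategy_def \<tau>_def last_tl)
  moreover have "\<exists>t. target (p t)" if p: "game_play mine move \<tau> s p" for p
  proof -
    have "p 0 = s" "p (Suc 0) = \<tau> (map p [0..<Suc 0])"
      using p mine.hyps unfolding game_play_def by metis+
    then have "p 1 = s'"
      by (simp add: \<tau>_def)
    moreover have "game_play mine move \<tau>' (p 1) (\<lambda>i. p (Suc i))"
      using game_play_shift[OF p] by (simp add: \<tau>_def)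
    ultimately show ?thesis
      using \<tau>'(2) by blast
  qed
  ultimately show ?case
    by blast
next
  case (other s)
  obtain f where f: "\<And>s. move s (f s)"
    using total by metis
  have "\<forall>s'. \<exists>\<tau>. move s s' \<longrightarrow> legal_strategy mine move \<tau> \<and>
      (\<forall>p. game_play mine move \<tau> s' p \<longrightarrow> (\<exists>t. target (p t)))"
    using other.IH by blast
  then obtain T where T: "\<And>s'. move s s' \<Longrightarrow> legal_strategy mine move (T s')"
    "\<And>s' p. move s s' \<Longrightarrow> game_play mine move (T s') s' p \<Longrightarrow> \<exists>t. target (p t)"
    by metis
  \<comment> \<open>The opponent's first move is the second entry of the history and selects the
    strategy to continue with.\<close>
  define \<tau> where
    "\<tau> h = (if tl h = [] \<or> \<not> move s (hd (tl h)) then f (last h) else T (hd (tl h)) (tl h))" for h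
  have "legal_strategy mine move \<tau>"
    unfolding legal_strategy_def
  proof (intro allI impI)
    fix h :: "'a list"
    assume "h \<noteq> []" "mine (last h)"
    then show "move (last h) (\<tau> h)"
      using T(1)[unfolded legal_strategy_def, rule_format, of "hd (tl h)" "tl h"] f
      by (simp add: \<tau>_def last_tl)
  qed
  moreover have "\<exists>t. target (p t)" if p: "game_play mine move \<tau> s p" for p
  proof -
    have "move s (p 1)"
      using p other.hyps unfolding game_play_def by (metis One_nat_def)
    moreover from this have "game_play mine move (T (p 1)) (p 1) (\<lambda>i. p (Suc i))"
      using game_play_shift[OF p] by (simp add: \<tau>_def)
    ultimately show ?thesis
      using T(2) by blast
  qed
  ultimately show ?case
    by blast
qed

text \<open>The complement of the attractor is a trap: by \<open>attractor.mine\<close> no own move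
  leaves it, and by \<open>attractor.other\<close> the opponent always has a move staying in
  it.\<close>

lemma not_attractor_imp_evading_play:
  assumes "\<not> attractor mine move target s" and "legal_strategy mine move \<tau>"
  shows "\<exists>p. game_play mine move \<tau> s p \<and> (\<forall>t. \<not> target (p t))"
proof -
  define step where "step h = (if mine (last h) then \<tau> h
      else SOME s'. move (last h) s' \<and> \<not> attractor mine move target s')" for h
  \<comment> \<open>The recursion produces whole histories, because \<open>\<tau>\<close> reads the
    whole past; \<open>p\<close> then picks their last states.\<close>
  define hist where "hist = rec_nat [s] (\<lambda>_ h. h @ [step h])"
  have hist: "hist 0 = [s]" "\<And>t. hist (Suc t) = hist t @ [step (hist t)]"
    by (simp_all add: hist_def)
  define p where "p t = last (hist t)" for t
  have ne: "hist t \<noteq> []" for t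
    by (cases t) (simp_all add: hist)
  have p: "p 0 = s" "\<And>t. p (Suc t) = step (hist t)"
    by (simp_all add: p_def hist)
  have hist_p: "hist t = map p [0..<Suc t]" for t
    by (induction t) (simp_all add: hist p)
  have move_step: "move (p t) (step (hist t)) \<and> \<not> attractor mine move target (step (hist t))"
    if "\<not> attractor mine move target (p t)" for t
  proof (cases "mine (p t)")
    case True
    then have "step (hist t) = \<tau> (hist t)"
      by (simp add: step_def p_def)
    moreover have "move (p t) (\<tau> (hist t))"
      using assms(2) ne True unfolding legal_strategy_def p_def by blast
    ultimately show ?thesis
      using True that attractor.mine by metis
  next
    case False
    then have "\<exists>s'. move (p t) s' \<and> \<not> attractor mine move target s'"
      using that attractor.other by metis
    from someI_ex[OF this] show ?thesis
      using False by (simp add: step_def p_def)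
  qed
  have not_attr: "\<not> attractor mine move target (p t)" for t
    by (induction t) (use assms(1) p move_step in auto)
  have "game_play mine move \<tau> s p"
    unfolding game_play_def
  proof (intro conjI allI)
    fix t
    show "if mine (p t) then p (Suc t) = \<tau> (map p [0..<Suc t]) else move (p t) (p (Suc t))"
      using move_step[OF not_attr[of t]] unfolding hist_p[symmetric] p(2)
      by (auto simp: step_def p_def)
  qed (simp add: p)
  then show ?thesis
    using not_attr attractor.target by metis
qed

text \<open>Trades history-dependent strategies and infinite plays for an inductive predicate, in
  terms of which both games are then analysed.\<close>

lemma strategy_iff_attractor:
  assumes "\<And>s. \<exists>s'. move s s'"
  shows "(\<exists>\<tau>. legal_strategy mine move \<tau> \<and>
      (\<forall>p. game_play mine move \<tau> s p \<longrightarrow> (\<exists>t. target (p t))))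
    \<longleftrightarrow> attractor mine move target s"
proof
  assume "attractor mine move target s"
  then show "\<exists>\<tau>. legal_strategy mine move \<tau> \<and>
      (\<forall>p. game_play mine move \<tau> s p \<longrightarrow> (\<exists>t. target (p t)))"
    using assms by (rule attractor_imp_strategy)
next
  assume "\<exists>\<tau>. legal_strategy mine move \<tau> \<and>
      (\<forall>p. game_play mine move \<tau> s p \<longrightarrow> (\<exists>t. target (p t)))"
  then obtain \<tau> where \<tau>: "legal_strategy mine move \<tau>"
      "\<forall>p. game_play mine move \<tau> s p \<longrightarrow> (\<exists>t. target (p t))"
    by blast
  show "attractor mine move target s"
  proof (rule ccontr)
    assume "\<not> attractor mine move target s"
    from not_attractor_imp_evading_play[OF this \<tau>(1)] \<tau>(2) show False
      by blast
  qed
qed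

text \<open>Evasion is proved through this rule: induction carries the invariant \<open>I\<close>
  along the attractor derivation until a target is reached, which \<open>I\<close> forbids.\<close>

lemma attractor_trap:
  assumes "attractor mine move target s" and "I s"
    and "\<And>s. I s \<Longrightarrow> \<not> target s"
    and "\<And>s s'. I s \<Longrightarrow> mine s \<Longrightarrow> move s s' \<Longrightarrow> I s'"
    and "\<And>s. I s \<Longrightarrow> \<not> mine s \<Longrightarrow> \<exists>s'. move s s' \<and> I s'"
  shows False
  using assms(1,2)
proof induction
  case (target s)
  then show ?case
    using assms(3) by blast
next
  case (mine s s')
  from assms(4)[OF mine.prems mine.hyps(1,2)] show ?case
    by (rule mine.IH)
next
  case (other s)
  from assms(5)[OF other.prems other.hyps(1)] obtain s' where "move s s'" "I s'"
    by blast
  then show ?case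
    by (rule other.IH)
qed

section \<open>The classical game\<close>

lemma cnbhd_refl [simp]: "v \<in> cnbhd E v"
  by (simp add: cnbhd_def)

fun classical_move :: "('a \<Rightarrow> 'a \<Rightarrow> bool) \<Rightarrow> 'a cstate \<Rightarrow> 'a cstate \<Rightarrow> bool" where
  "classical_move E (cs, r, True) s' \<longleftrightarrow>
     (\<exists>cs'. list_all2 (\<lambda>x y. y \<in> cnbhd E x) cs cs' \<and> s' = (cs', r, False))"
| "classical_move E (cs, r, False) s' \<longleftrightarrow> (\<exists>r' \<in> cnbhd E r. s' = (cs, r', True))"

abbreviation classical_win :: "('a \<Rightarrow> 'a \<Rightarrow> bool) \<Rightarrow> 'a cstate \<Rightarrow> bool" where
  "classical_win E \<equiv> attractor (\<lambda>s. snd (snd s)) (classical_move E) classical_capture"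

lemma classical_move_total: "\<exists>s'. classical_move E s s'"
\<comment> \<open>The case rule of \<open>classical_move\<close> serves to split a state by its turn
  flag.\<close>
proof (cases "(E, s, s)" rule: classical_move.cases)
  case (1 _ cs r)
  have "list_all2 (\<lambda>x y. y \<in> cnbhd E x) cs cs"
    by (simp add: list_all2_refl)
  with 1 show ?thesis
    by auto
next
  case (2 _ cs r)
  then show ?thesis
    by (auto intro: cnbhd_refl)
qed

text \<open>Strategies of the classical game return cop positions only, those of a reachability game
  whole states. Adding the robber's position and the flag, or projecting with \<open>fst\<close>,
  converts one into the other, since legal cop moves fix the remaining components.\<close>

lemma classical_strategy_iff_win:
  "(\<exists>\<sigma>. classical_legal_strategy E \<sigma> \<and>
      (\<forall>p. classical_play E \<sigma> s p \<longrightarrow> (\<exists>t. classical_capture (p t)))) \<longleftrightarrow> classical_win E s"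
  (is "?L \<longleftrightarrow> _")
proof -
  let ?mine = "\<lambda>s::'a cstate. snd (snd s)"
  have play_iff: "classical_play E \<sigma> s p \<longleftrightarrow> game_play ?mine (classical_move E) \<tau> s p"
    if "\<And>h. h \<noteq> [] \<Longrightarrow> ?mine (last h) \<Longrightarrow> \<tau> h = (\<sigma> h, fst (snd (last h)), False)" for \<sigma> \<tau> p
  proof -
    have "(case p t of (cs, r, b) \<Rightarrow>
        (if b then p (Suc t) = (\<sigma> (map p [0..<Suc t]), r, False)
         else (\<exists>r' \<in> cnbhd E r. p (Suc t) = (cs, r', True)))) \<longleftrightarrow>
      (if ?mine (p t) then p (Suc t) = \<tau> (map p [0..<Suc t])
       else classical_move E (p t) (p (Suc t)))" for t
      using that[of "map p [0..<Suc t]"]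
      by (cases "(E, p t, p t)" rule: classical_move.cases) auto
    then show ?thesis
      by (simp add: classical_play_def game_play_def)
  qed
  have "?L \<longleftrightarrow> (\<exists>\<tau>. legal_strategy ?mine (classical_move E) \<tau> \<and>
      (\<forall>p. game_play ?mine (classical_move E) \<tau> s p \<longrightarrow> (\<exists>t. classical_capture (p t))))"
    (is "_ \<longleftrightarrow> ?R")
  proof
    assume ?L
    then obtain \<sigma> where \<sigma>: "classical_legal_strategy E \<sigma>"
      "\<And>p. classical_play E \<sigma> s p \<Longrightarrow> \<exists>t. classical_capture (p t)"
      by blast
    define \<tau> where "\<tau> h = (\<sigma> h, fst (snd (last h)), False)" for h
    have "classical_move E (last h) (\<tau> h)" if h_mine: "h \<noteq> []" "?mine (last h)" for h
    proof -
      obtain cs r where h: "last h = (cs, r, True)"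
        using h_mine(2) by (cases "last h") auto
      have "length (\<sigma> h) = length cs \<and> (\<forall>j < length cs. \<sigma> h ! j \<in> cnbhd E (cs ! j))"
        using \<sigma>(1) h_mine h unfolding classical_legal_strategy_def by fastforce
      then show ?thesis
        by (simp add: h \<tau>_def list_all2_conv_all_nth)
    qed
    then have "legal_strategy ?mine (classical_move E) \<tau>"
      by (simp add: legal_strategy_def)
    moreover have "classical_play E \<sigma> s p \<longleftrightarrow> game_play ?mine (classical_move E) \<tau> s p" for p
      by (rule play_iff) (simp add: \<tau>_def)
    ultimately show ?R
      using \<sigma>(2) by blast
  next
    assume ?R
    then obtain \<tau> where \<tau>: "legal_strategy ?mine (classical_move E) \<tau>"
      "\<And>p. game_play ?mine (classical_move E) \<tau> s p \<Longrightarrow> \<exists>t. classical_capture (p t)"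
      by blast
    define \<sigma> where "\<sigma> h = fst (\<tau> h)" for h
    have \<tau>_eq: "\<tau> h = (\<sigma> h, fst (snd (last h)), False) \<and>
        list_all2 (\<lambda>x y. y \<in> cnbhd E x) (fst (last h)) (\<sigma> h)"
      if h_mine: "h \<noteq> []" "?mine (last h)" for h
    proof -
      obtain cs r where h: "last h = (cs, r, True)"
        using h_mine(2) by (cases "last h") auto
      have "classical_move E (last h) (\<tau> h)"
        using \<tau>(1) h_mine by (simp add: legal_strategy_def)
      then show ?thesis
        by (auto simp: h \<sigma>_def)
    qed
    have "classical_legal_strategy E \<sigma>"
      unfolding classical_legal_strategy_def
      using \<tau>_eq by (auto simp: list_all2_conv_all_nth)
    moreover have "classical_play E \<sigma> s p \<longleftrightarrow> game_play ?mine (classical_move E) \<tau> s p" for p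
      by (rule play_iff) (use \<tau>_eq in blast)
    ultimately show ?L
      using \<tau>(2) by blast
  qed
  also have "\<dots> \<longleftrightarrow> classical_win E s"
    by (rule strategy_iff_attractor) (rule classical_move_total)
  finally show ?thesis .
qed

lemma classical_cops_win_iff:
  "classical_cops_win V E k \<longleftrightarrow>
    (\<forall>cs r. length cs = k \<longrightarrow> set cs \<subseteq> V \<longrightarrow> r \<in> V \<longrightarrow> classical_win E (cs, r, True))"
  unfolding classical_cops_win_def classical_strategy_iff_win by blast

section \<open>Graph facts and walking cops to a prescribed placement\<close>

lemma fsc_graph_finite: "fsc_graph V E \<Longrightarrow> finite V"
  unfolding fsc_graph_def by (elim conjE)

lemma fsc_graph_nonempty: "fsc_graph V E \<Longrightarrow> V \<noteq> {}"
  unfolding fsc_graph_def by (elim conjE)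

lemma fsc_graph_cnbhd_subset: "fsc_graph V E \<Longrightarrow> v \<in> V \<Longrightarrow> cnbhd E v \<subseteq> V"
  unfolding fsc_graph_def cnbhd_def by blast

lemma fsc_graph_cnbhd_sym: "fsc_graph V E \<Longrightarrow> u \<in> cnbhd E v \<longleftrightarrow> v \<in> cnbhd E u"
  unfolding fsc_graph_def cnbhd_def by blast

lemma classical_win_cops_moveI:
  assumes "list_all2 (\<lambda>x y. y \<in> cnbhd E x) cs cs'" and "classical_win E (cs', r, False)"
  shows "classical_win E (cs, r, True)"
  by (rule attractor.mine[OF _ _ assms(2)]) (use assms(1) in auto)

lemma classical_win_robber_moveI:
  assumes "\<And>r'. r' \<in> cnbhd E r \<Longrightarrow> classical_win E (cs, r', True)"
  shows "classical_win E (cs, r, False)"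
  by (rule attractor.other) (use assms in auto)

lemma classical_win_cop_step:
  assumes "fsc_graph V E" and "\<And>r. r \<in> V \<Longrightarrow> classical_win E (ds, r, True)"
    and "list_all2 (\<lambda>x y. y \<in> cnbhd E x) cs ds" and "r \<in> V"
  shows "classical_win E (cs, r, True)"
proof (rule classical_win_cops_moveI[OF assms(3)], rule classical_win_robber_moveI)
  fix r'
  assume "r' \<in> cnbhd E r"
  then have "r' \<in> V"
    using fsc_graph_cnbhd_subset[OF assms(1,4)] by blast
  then show "classical_win E (ds, r', True)"
    by (rule assms(2))
qed

text \<open>Induction along the path from its end: one cop walks while the others stay put, and each
  edge is an instance of \<open>classical_win_cop_step\<close>.\<close>

lemma classical_win_walk_cop:
  assumes "fsc_graph V E" and "\<And>r. r \<in> V \<Longrightarrow> classical_win E (ds, r, True)"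
    and "j < length ds" and "E\<^sup>*\<^sup>* u (ds ! j)" and "r \<in> V"
  shows "classical_win E (ds[j := u], r, True)"
  using assms(4,5)
proof (induction arbitrary: r rule: converse_rtranclp_induct)
  case base
  then show ?case
    using assms(2) by simp
next
  case (step u w)
  have "list_all2 (\<lambda>x y. y \<in> cnbhd E x) (ds[j := u]) (ds[j := w])"
    using step.hyps assms(3)
    by (intro list_all2_update_cong list_all2_refl) (simp_all add: cnbhd_def)
  from classical_win_cop_step[OF assms(1) step.IH this step.prems] show ?case .
qed

text \<open>The cops walk to \<open>ds\<close> one after another, whatever the robber does
  meanwhile. Contrapositively, if some position is not won, then every placement of as many cops
  fails against a suitable robber vertex.\<close>

lemma classical_win_any_placement:
  assumes G: "fsc_graph V E" and "\<And>r. r \<in> V \<Longrightarrow> classical_win E (ds, r, True)"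
    and len: "length cs = length ds" and V: "set cs \<subseteq> V" "set ds \<subseteq> V" and "r \<in> V"
  shows "classical_win E (cs, r, True)"
proof -
  \<comment> \<open>Hybrid placements: the first \<open>i\<close> cops still have to walk, the
    others already stand as in \<open>ds\<close>.\<close>
  have "classical_win E (take i cs @ drop i ds, r, True)" if "i \<le> length cs" "r \<in> V" for i r
    using that
  proof (induction i arbitrary: r)
    case 0
    then show ?case
      using assms(2) by simp
  next
    case (Suc i)
    let ?ds = "take i cs @ drop i ds"
    have i: "i < length cs" "i < length ds"
      using Suc.prems len by simp_all
    then have nth: "?ds ! i = ds ! i"
      by (simp add: nth_append)
    have "take (Suc i) cs @ drop (Suc i) ds = ?ds[i := cs ! i]"
      using i by (simp add: take_Suc_conv_app_nth list_update_append Cons_nth_drop_Suc[symmetric])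
    moreover have "cs ! i \<in> V" "ds ! i \<in> V"
      using i V nth_mem by blast+
    then have "E\<^sup>*\<^sup>* (cs ! i) (?ds ! i)"
      using G unfolding nth fsc_graph_def by blast
    ultimately show ?case
      using classical_win_walk_cop[OF G, of ?ds i] Suc i by simp
  qed
  from this[of "length cs"] show ?thesis
    using assms by simp
qed

text \<open>The placement occupying all vertices captures at once and can be reached from
  everywhere. So the \<open>LEAST\<close> in \<open>cop_number\<close> is attained.\<close>

lemma classical_cops_win_card:
  assumes "fsc_graph V E"
  shows "classical_cops_win V E (card V)"
proof -
  obtain ds where ds: "set ds = V" "distinct ds"
    using finite_distinct_list[OF fsc_graph_finite[OF assms]] by blast
  have win: "classical_win E (ds, r, True)" if "r \<in> V" for r
    by (rule attractor.target) (use that ds in \<open>simp add: classical_capture_def\<close>)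
  show ?thesis
    unfolding classical_cops_win_iff
  proof (intro allI impI)
    fix cs r
    assume "length cs = card V" "set cs \<subseteq> V" "r \<in> V"
    then show "classical_win E (cs, r, True)"
      using ds distinct_card[OF ds(2)]
      by (intro classical_win_any_placement[OF assms win]) simp_all
  qed
qed

text \<open>Excludes cop number 0, a value that no state cop number takes. Without cops no capture
  ever occurs, so the empty cop list is an invariant.\<close>

lemma not_classical_cops_win_0:
  assumes "fsc_graph V E"
  shows "\<not> classical_cops_win V E 0"
proof
  assume win: "classical_cops_win V E 0"
  obtain v where "v \<in> V"
    using fsc_graph_nonempty[OF assms] by blast
  with win have "classical_win E ([], v, True)"
    by (simp add: classical_cops_win_iff)
  then show False
  proof (rule attractor_trap[where I = "\<lambda>s. fst s = []"])
    have no_cops: "fst s' = []" if "fst s = []" "classical_move E s s'" for s s'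
      using that by (cases "(E, s, s')" rule: classical_move.cases) auto
    show "fst s' = []" if "fst s = []" "classical_move E s s'" for s s'
      using no_cops[OF that] .
    show "\<exists>s'. classical_move E s s' \<and> fst s' = []" if "fst s = []" for s
      using no_cops[OF that] classical_move_total by blast
  qed (simp_all add: classical_capture_def)
qed

text \<open>Otherwise the cop at \<open>x\<close> steps onto the robber.\<close>

lemma not_classical_win_robber_far:
  assumes "\<not> classical_win E (cs, r, True)" and "x \<in> set cs"
  shows "r \<notin> cnbhd E x"
proof
  assume r: "r \<in> cnbhd E x"
  obtain j where j: "j < length cs" "cs ! j = x"
    using assms(2) by (auto simp: in_set_conv_nth)
  have "list_all2 (\<lambda>x y. y \<in> cnbhd E x) cs (cs[j := r])"
    using j r by (auto simp: list_all2_conv_all_nth nth_list_update)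
  moreover have "classical_win E (cs[j := r], r, False)"
    by (rule attractor.target) (simp add: classical_capture_def set_update_memI j)
  ultimately show False
    using assms(1) classical_win_cops_moveI by metis
qed

section \<open>The pregame\<close>

definition pregame_move :: "('a \<Rightarrow> 'a \<Rightarrow> bool) \<Rightarrow> nat \<Rightarrow> 'a pstate \<Rightarrow> 'a pstate \<Rightarrow> bool" where
  "pregame_move E N s s' \<longleftrightarrow> (\<exists>y \<in> cnbhd E (fst s ! (snd s - 1)).
     s' = ((fst s)[snd s - 1 := y], next_token N (snd s)))"

abbreviation pregame_win :: "('a \<Rightarrow> 'a \<Rightarrow> bool) \<Rightarrow> nat \<Rightarrow> nat set \<Rightarrow> 'a pstate \<Rightarrow> bool" where
  "pregame_win E N C \<equiv> attractor (\<lambda>s. snd s \<in> C) (pregame_move E N) (is_capture N)"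

lemma pregame_strategy_iff_win:
  "(\<exists>\<sigma>. pregame_legal_strategy E C \<sigma> \<and>
      (\<forall>p. pregame_play E N C \<sigma> s p \<longrightarrow> (\<exists>t. is_capture N (p t)))) \<longleftrightarrow> pregame_win E N C s"
  (is "?L \<longleftrightarrow> _")
proof -
  let ?mine = "\<lambda>s::'a pstate. snd s \<in> C"
  let ?next = "\<lambda>(\<sigma> :: nat \<Rightarrow> 'a pstate list \<Rightarrow> 'a) h.
    ((fst (last h))[snd (last h) - 1 := \<sigma> (snd (last h)) h], next_token N (snd (last h)))"
  have play_iff: "pregame_play E N C \<sigma> s p \<longleftrightarrow> game_play ?mine (pregame_move E N) \<tau> s p"
    if "\<And>h. h \<noteq> [] \<Longrightarrow> ?mine (last h) \<Longrightarrow> \<tau> h = ?next \<sigma> h" for \<sigma> \<tau> p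
  proof -
    have "(case p t of (xs, n) \<Rightarrow>
        (if n \<in> C then p (Suc t) = (xs[n - 1 := \<sigma> n (map p [0..<Suc t])], next_token N n)
         else (\<exists>y \<in> cnbhd E (xs ! (n - 1)). p (Suc t) = (xs[n - 1 := y], next_token N n)))) \<longleftrightarrow>
      (if ?mine (p t) then p (Suc t) = \<tau> (map p [0..<Suc t])
       else pregame_move E N (p t) (p (Suc t)))" for t
      using that[of "map p [0..<Suc t]"] by (cases "p t") (auto simp: pregame_move_def)
    then show ?thesis
      by (simp add: pregame_play_def game_play_def)
  qed
  have "?L \<longleftrightarrow> (\<exists>\<tau>. legal_strategy ?mine (pregame_move E N) \<tau> \<and>
      (\<forall>p. game_play ?mine (pregame_move E N) \<tau> s p \<longrightarrow> (\<exists>t. is_capture N (p t))))"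
    (is "_ \<longleftrightarrow> ?R")
  proof
    assume ?L
    then obtain \<sigma> where \<sigma>: "pregame_legal_strategy E C \<sigma>"
      "\<And>p. pregame_play E N C \<sigma> s p \<Longrightarrow> \<exists>t. is_capture N (p t)"
      by blast
    have "legal_strategy ?mine (pregame_move E N) (?next \<sigma>)"
      using \<sigma>(1)
      by (auto simp: legal_strategy_def pregame_legal_strategy_def pregame_move_def pos_def)
    moreover have "pregame_play E N C \<sigma> s p \<longleftrightarrow>
        game_play ?mine (pregame_move E N) (?next \<sigma>) s p" for p
      by (rule play_iff) simp
    ultimately show ?R
      using \<sigma>(2) by blast
  next
    assume ?R
    then obtain \<tau> where \<tau>: "legal_strategy ?mine (pregame_move E N) \<tau>"
      "\<And>p. game_play ?mine (pregame_move E N) \<tau> s p \<Longrightarrow> \<exists>t. is_capture N (p t)"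
      by blast
    define \<sigma> where "\<sigma> i h = fst (\<tau> h) ! (i - 1)" for i h
    have \<tau>_eq: "\<tau> h = ?next \<sigma> h \<and> \<sigma> (snd (last h)) h \<in> cnbhd E (pos (last h) (snd (last h)))"
      if "h \<noteq> []" "?mine (last h)" for h
    proof -
      have "pregame_move E N (last h) (\<tau> h)"
        using \<tau>(1) that by (simp add: legal_strategy_def)
      \<comment> \<open>If the token has no entry in the list, the update has no effect and the
        value read back is the old one, which lies in its own closed neighbourhood.\<close>
      then show ?thesis
        by (cases "snd (last h) - 1 < length (fst (last h))")
          (auto simp: pregame_move_def \<sigma>_def pos_def list_update_beyond)
    qed
    have "pregame_legal_strategy E C \<sigma>"
      unfolding pregame_legal_strategy_def using \<tau>_eq by blast
    moreover have "pregame_play E N C \<sigma> s p \<longleftrightarrow> game_play ?mine (pregame_move E N) \<tau> s p" for p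
      by (rule play_iff) (use \<tau>_eq in blast)
    ultimately show ?L
      using \<tau>(2) by blast
  qed
  also have "\<dots> \<longleftrightarrow> pregame_win E N C s"
    by (rule strategy_iff_attractor) (auto simp: pregame_move_def intro: cnbhd_refl)
  finally show ?thesis .
qed

lemma k_cops_capture_iff:
  "k_cops_capture E N s k \<longleftrightarrow> (\<exists>C. C \<subseteq> {1..N-1} \<and> card C = k \<and> pregame_win E N C s)"
proof -
  have "k_cops_capture E N s k \<longleftrightarrow> (\<exists>C. C \<subseteq> {1..N-1} \<and> card C = k \<and>
      (\<exists>\<sigma>. pregame_legal_strategy E C \<sigma> \<and>
        (\<forall>p. pregame_play E N C \<sigma> s p \<longrightarrow> (\<exists>t. is_capture N (p t)))))"
    unfolding k_cops_capture_def by blast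
  then show ?thesis
    unfolding pregame_strategy_iff_win .
qed

section \<open>Simulating classical cops in the pregame\<close>

lemma pregame_win_ownI:
  assumes "n \<in> C" and "y \<in> cnbhd E (xs ! (n - 1))"
    and "pregame_win E N C (xs[n - 1 := y], next_token N n)"
  shows "pregame_win E N C (xs, n)"
  by (rule attractor.mine[OF _ _ assms(3)]) (use assms(1,2) in \<open>auto simp: pregame_move_def\<close>)

lemma pregame_win_otherI:
  assumes "n \<notin> C"
    and "\<And>y. y \<in> cnbhd E (xs ! (n - 1)) \<Longrightarrow> pregame_win E N C (xs[n - 1 := y], next_token N n)"
  shows "pregame_win E N C (xs, n)"
  by (rule attractor.other) (use assms in \<open>auto simp: pregame_move_def\<close>)

text \<open>Whoever controls the token, its move is irrelevant; a controlled token simply stays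
  put.\<close>

lemma pregame_win_anyI:
  assumes "\<And>y. y \<in> cnbhd E (xs ! (n - 1)) \<Longrightarrow> pregame_win E N C (xs[n - 1 := y], next_token N n)"
  shows "pregame_win E N C (xs, n)"
proof (cases "n \<in> C")
  case True
  from pregame_win_ownI[OF this cnbhd_refl assms[OF cnbhd_refl]] show ?thesis .
next
  case False
  from pregame_win_otherI[OF this assms] show ?thesis .
qed

text \<open>The simulation needs a round to begin with token 1. Until then the moves are arbitrary,
  and only membership of the positions in \<open>V\<close> has to be preserved.\<close>

lemma pregame_win_wait:
  assumes "fsc_graph V E"
    and "\<And>xs. length xs = N \<Longrightarrow> set xs \<subseteq> V \<Longrightarrow> pregame_win E N C (xs, 1)"
    and "1 \<le> n" and "n \<le> N" and "length xs = N" and "set xs \<subseteq> V"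
  shows "pregame_win E N C (xs, n)"
  using assms(4,3,5,6)
proof (induction n arbitrary: xs rule: inc_induct)
  have upd: "set (xs[n - 1 := y]) \<subseteq> V"
    if "1 \<le> n" "n \<le> N" "length xs = N" "set xs \<subseteq> V" "y \<in> cnbhd E (xs ! (n - 1))" for n xs y
  proof -
    have "xs ! (n - 1) \<in> set xs"
      using that by simp
    then have "y \<in> V"
      using that fsc_graph_cnbhd_subset[OF assms(1)] by blast
    then show ?thesis
      using that(4) set_update_subset_insert by fast
  qed
  {
    case base
    show ?case
      by (rule pregame_win_anyI) (use base assms(2) upd in \<open>simp add: next_token_def\<close>)
  next
    case (step n)
    show ?case
      by (rule pregame_win_anyI) (use step upd[of n] in \<open>simp add: next_token_def\<close>)
  }
qed

text \<open>Tokens \<open>k + 1\<close> to \<open>N - 1\<close> are played by the opponent, but they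
  change neither the first \<open>k\<close> positions nor the robber's, and the assumption depends
  on nothing else.\<close>

lemma pregame_win_idle_cops:
  assumes "\<And>xs'. length xs' = N \<Longrightarrow> take k xs' = take k xs \<Longrightarrow> xs' ! (N - 1) = xs ! (N - 1)
      \<Longrightarrow> pregame_win E N {1..k} (xs', N)"
    and "k < n" and "n \<le> N" and "length xs = N"
  shows "pregame_win E N {1..k} (xs, n)"
  using assms(3,2,1,4)
proof (induction n arbitrary: xs rule: inc_induct)
  case base
  then show ?case
    by blast
next
  case (step n)
  show ?case
  proof (rule pregame_win_otherI)
    fix y
    have "pregame_win E N {1..k} (xs[n - 1 := y], Suc n)"
      using step.prems step.hyps by (intro step.IH) auto
    then show "pregame_win E N {1..k} (xs[n - 1 := y], next_token N n)"
      using step.hyps by (simp add: next_token_def)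
  qed (use step.prems in simp)
qed

text \<open>Splits a simultaneous cop move into \<open>k\<close> token moves. When token
  \<open>Suc i\<close> moves, the first \<open>i\<close> cops already stand as in
  \<open>cs'\<close>; list indices lag token numbers by one.\<close>

lemma pregame_win_moving_cops:
  assumes "\<And>xs'. length xs' = N \<Longrightarrow> take k xs' = cs' \<Longrightarrow> xs' ! (N - 1) = r
      \<Longrightarrow> pregame_win E N {1..k} (xs', Suc k)"
    and "k \<le> N - 1" and "N \<ge> 2" and "length cs' = k"
    and "i \<le> k" and "length xs = N" and "xs ! (N - 1) = r" and "take i xs = take i cs'"
    and "\<And>j. i \<le> j \<Longrightarrow> j < k \<Longrightarrow> cs' ! j \<in> cnbhd E (xs ! j)"
  shows "pregame_win E N {1..k} (xs, Suc i)"
  using assms(5-)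
proof (induction i arbitrary: xs rule: inc_induct)
  case base
  then show ?case
    using assms(1,4) by simp
next
  case (step i)
  have step_win: "pregame_win E N {1..k} (xs[i := cs' ! i], Suc (Suc i))"
    using step.prems step.hyps assms(2-4)
    by (intro step.IH) (auto simp: take_Suc_conv_app_nth)
  show ?case
    by (rule pregame_win_ownI[where y = "cs' ! i"])
      (use step.prems(4)[of i] step.hyps assms(2,3) step_win in \<open>auto simp: next_token_def\<close>)
qed

text \<open>Induction on the classical attractor: a cop turn becomes the moves of tokens 1 to
  \<open>k\<close> followed by the irrelevant moves of the other cops, a robber turn the move of
  token \<open>N\<close>. \<open>xs\<close> is generalised because the positions of the other cops
  are arbitrary.\<close>

lemma classical_win_imp_pregame_win:
  assumes "classical_win E s" and k: "k \<le> N - 1" and N: "N \<ge> 2"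
    and "length xs = N" and "take k xs = fst s" and "xs ! (N - 1) = fst (snd s)"
  shows "pregame_win E N {1..k} (xs, if snd (snd s) then 1 else N)"
  using assms(1,4-)
proof (induction arbitrary: xs)
  case (target s)
  then have "xs ! (N - 1) \<in> set (take k xs)"
    by (simp add: classical_capture_def)
  then obtain j where j: "j < k" "xs ! j = xs ! (N - 1)"
    by (auto simp: in_set_conv_nth)
  then have "Suc j \<in> {1..N - 1}" "pos (xs, n) (Suc j) = pos (xs, n) N" for n
    using k by (auto simp: pos_def)
  then have "is_capture N (xs, n)" for n
    unfolding is_capture_def by blast
  then show ?case
    by (rule attractor.target)
next
  case (mine s s')
  obtain cs r where s: "s = (cs, r, True)"
    using mine.hyps(1) by (cases s) auto
  obtain cs' where cs': "list_all2 (\<lambda>x y. y \<in> cnbhd E x) cs cs'" "s' = (cs', r, False)"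
    using mine.hyps(2) s by auto
  have len: "length cs = k"
    using mine.prems s k by auto
  have "pregame_win E N {1..k} (xs, Suc 0)"
  proof (rule pregame_win_moving_cops[OF _ k N])
    fix xs' :: "'a list"
    assume xs': "length xs' = N" "take k xs' = cs'" "xs' ! (N - 1) = r"
    show "pregame_win E N {1..k} (xs', Suc k)"
    proof (rule pregame_win_idle_cops)
      fix ys :: "'a list"
      assume "length ys = N" "take k ys = take k xs'" "ys ! (N - 1) = xs' ! (N - 1)"
      then show "pregame_win E N {1..k} (ys, N)"
        using mine.IH[of ys] xs' cs'(2) by simp
    qed (use xs' k N in auto)
  next
    fix j
    assume "j < k"
    then show "cs' ! j \<in> cnbhd E (xs ! j)"
      using cs'(1) len mine.prems(2) s by (auto simp: list_all2_conv_all_nth)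
  qed (use cs'(1) len mine.prems s in \<open>auto simp: list_all2_lengthD\<close>)
  then show ?case
    by (simp add: s)
next
  case (other s)
  obtain cs r where s: "s = (cs, r, False)"
    using other.hyps by (cases s) auto
  have "pregame_win E N {1..k} (xs, N)"
  proof (rule pregame_win_otherI)
    fix y
    assume y: "y \<in> cnbhd E (xs ! (N - 1))"
    then have "classical_move E s (cs, y, True)"
      using other.prems s by simp
    from other.IH[OF this, of "xs[N - 1 := y]"]
    show "pregame_win E N {1..k} (xs[N - 1 := y], next_token N N)"
      using other.prems s k N by (simp add: next_token_def)
  qed (use k N in auto)
  then show ?case
    by (simp add: s)
qed

lemma classical_cops_win_imp_k_cops_capture:
  assumes G: "fsc_graph V E" and N: "N \<ge> 2" and k: "k \<le> N - 1"
    and win: "classical_cops_win V E k" and s: "s \<in> S_nc V N"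
  shows "k_cops_capture E N s k"
proof -
  obtain xs n where xs: "s = (xs, n)" "length xs = N" "set xs \<subseteq> V" "1 \<le> n" "n \<le> N"
    using s by (cases s) (auto simp: S_nc_def)
  have "pregame_win E N {1..k} (xs, n)"
  proof (rule pregame_win_wait[OF G _ xs(4,5,2,3)])
    fix ys :: "'a list"
    assume ys: "length ys = N" "set ys \<subseteq> V"
    have "ys ! (N - 1) \<in> V" "set (take k ys) \<subseteq> V" "length (take k ys) = k"
      using ys N k set_take_subset[of k ys] by (auto simp: subset_iff)
    then have "classical_win E (take k ys, ys ! (N - 1), True)"
      using win unfolding classical_cops_win_iff by blast
    then show "pregame_win E N {1..k} (ys, 1)"
      using classical_win_imp_pregame_win[OF _ k N ys(1)] by fastforce
  qed
  then show ?thesis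
    unfolding k_cops_capture_iff xs(1) using k by (intro exI[of _ "{1..k}"]) auto
qed

section \<open>Evading too few cops\<close>

text \<open>Here \<open>b\<close> records the positions of the cops of \<open>C\<close> at the beginning of the current round, and
  \<open>i\<^sub>0\<close> is the cop followed by those outside \<open>C\<close>. The list \<open>Cl\<close> enumerates \<open>C\<close>, possibly
  with repetitions: a cop that occurs twice stands for two classical cops moving together.\<close>

definition on_track ::
  "('a \<Rightarrow> 'a \<Rightarrow> bool) \<Rightarrow> nat list \<Rightarrow> nat \<Rightarrow> (nat \<Rightarrow> 'a) \<Rightarrow> nat \<Rightarrow> nat \<Rightarrow> 'a \<Rightarrow> bool" where
  "on_track E Cl i\<^sub>0 b n i x \<longleftrightarrow>
     (if i \<in> set Cl then (if i < n then x \<in> cnbhd E (b i) else x = b i)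
      else (if i < n then x = b i\<^sub>0 else b i\<^sub>0 \<in> cnbhd E x))"

text \<open>The robber's invariant. The flag is \<open>True\<close> whichever token is to move: in
  mid-round the robber is still compared with the cop positions \<open>b\<close> at the start of the
  round, and moves made since then are recorded by \<open>on_track\<close> only.\<close>

definition evasive :: "('a \<Rightarrow> 'a \<Rightarrow> bool) \<Rightarrow> nat \<Rightarrow> nat list \<Rightarrow> nat \<Rightarrow> 'a pstate \<Rightarrow> bool" where
  "evasive E N Cl i\<^sub>0 s \<longleftrightarrow> length (fst s) = N \<and> snd s \<in> {1..N} \<and>
     (\<exists>b. \<not> classical_win E (map b Cl, fst s ! (N - 1), True) \<and>
       (\<forall>i\<in>{1..N-1}. on_track E Cl i\<^sub>0 b (snd s) i (fst s ! (i - 1))))"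

lemma evasiveI:
  assumes "length xs = N" and "1 \<le> n" and "n \<le> N"
    and "\<not> classical_win E (map b Cl, xs ! (N - 1), True)"
    and "\<And>i. i \<in> {1..N-1} \<Longrightarrow> on_track E Cl i\<^sub>0 b n i (xs ! (i - 1))"
  shows "evasive E N Cl i\<^sub>0 (xs, n)"
proof -
  have "\<forall>i\<in>{1..N-1}. on_track E Cl i\<^sub>0 b n i (xs ! (i - 1))"
    using assms(5) by (rule ballI)
  with assms(4) have "\<exists>b. \<not> classical_win E (map b Cl, xs ! (N - 1), True) \<and>
      (\<forall>i\<in>{1..N-1}. on_track E Cl i\<^sub>0 b n i (xs ! (i - 1)))"
    by (intro exI[of _ b] conjI)
  then show ?thesis
    unfolding evasive_def fst_conv snd_conv atLeastAtMost_iff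
    using assms(1-3) by (intro conjI)
qed

lemma evasiveE:
  assumes "evasive E N Cl i\<^sub>0 s"
  obtains xs n b where "s = (xs, n)" and "length xs = N" and "1 \<le> n" and "n \<le> N"
    and "\<not> classical_win E (map b Cl, xs ! (N - 1), True)"
    and "\<forall>i\<in>{1..N-1}. on_track E Cl i\<^sub>0 b n i (xs ! (i - 1))"
proof -
  obtain b where "\<not> classical_win E (map b Cl, fst s ! (N - 1), True)"
    and "\<forall>i\<in>{1..N-1}. on_track E Cl i\<^sub>0 b (snd s) i (fst s ! (i - 1))"
    using assms unfolding evasive_def by blast
  moreover have "length (fst s) = N" "1 \<le> snd s" "snd s \<le> N"
    using assms unfolding evasive_def by simp_all
  ultimately show thesis
    by (intro that[of "fst s" "snd s" b]) simp_all
qed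

text \<open>A follower is on \<open>b i\<^sub>0\<close> or one move away from it, so symmetry of
  adjacency puts it near the starting vertex of the cop it follows.\<close>

lemma on_track_near:
  assumes "fsc_graph V E" and "i\<^sub>0 \<in> set Cl" and "on_track E Cl i\<^sub>0 b n i x"
  shows "\<exists>j\<in>set Cl. x \<in> cnbhd E (b j)"
proof (cases "i \<in> set Cl")
  case True
  then have "x \<in> cnbhd E (b i)"
    using assms(3) by (auto simp: on_track_def split: if_splits)
  with True show ?thesis ..
next
  case False
  then have "x \<in> cnbhd E (b i\<^sub>0)"
    using assms(3) fsc_graph_cnbhd_sym[OF assms(1), of x]
    by (auto simp: on_track_def split: if_splits)
  with assms(2) show ?thesis ..
qed

text \<open>Every cop token is within one move of some \<open>b j\<close> with \<open>j\<close> in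
  \<open>set Cl\<close>, whereas the robber, safe at the cops' turn, is not.\<close>

lemma evasive_not_capture:
  assumes "fsc_graph V E" and "i\<^sub>0 \<in> set Cl" and "evasive E N Cl i\<^sub>0 s"
  shows "\<not> is_capture N s"
proof
  assume "is_capture N s"
  then obtain i where i: "i \<in> {1..N-1}" "fst s ! (i - 1) = fst s ! (N - 1)"
    unfolding is_capture_def pos_def by blast
  from assms(3) obtain xs n b where s: "s = (xs, n)"
    and b: "\<not> classical_win E (map b Cl, xs ! (N - 1), True)"
    and track: "\<forall>i\<in>{1..N-1}. on_track E Cl i\<^sub>0 b n i (xs ! (i - 1))"
    by (rule evasiveE)
  obtain j where "j \<in> set Cl" "xs ! (i - 1) \<in> cnbhd E (b j)"
    using on_track_near[OF assms(1,2) bspec[OF track i(1)]] by blast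
  then show False
    using not_classical_win_robber_far[OF b, of "b j"] i(2) s by simp
qed

text \<open>A common step for cops inside and outside the coalition: \<open>b\<close> is kept, and
  raising the token to move from \<open>n\<close> to \<open>Suc n\<close> affects the condition for
  token \<open>n\<close> only.\<close>

lemma evasive_cop_move:
  assumes "length xs = N" and n: "1 \<le> n" "n < N"
    and "\<not> classical_win E (map b Cl, xs ! (N - 1), True)"
    and track: "\<And>i. i \<in> {1..N-1} \<Longrightarrow> on_track E Cl i\<^sub>0 b n i (xs ! (i - 1))"
    and y: "on_track E Cl i\<^sub>0 b (Suc n) n y"
  shows "evasive E N Cl i\<^sub>0 (xs[n - 1 := y], next_token N n)"
proof -
  have "evasive E N Cl i\<^sub>0 (xs[n - 1 := y], Suc n)"
  proof (rule evasiveI)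
    show "\<not> classical_win E (map b Cl, xs[n - 1 := y] ! (N - 1), True)"
      using assms(4) n by simp
    fix i
    assume i: "i \<in> {1..N-1}"
    show "on_track E Cl i\<^sub>0 b (Suc n) i (xs[n - 1 := y] ! (i - 1))"
    proof (cases "i = n")
      case True
      then show ?thesis
        using y n assms(1) by simp
    next
      case False
      then have "xs[n - 1 := y] ! (i - 1) = xs ! (i - 1)"
        using i n by (intro nth_list_update_neq) auto
      moreover have "i < Suc n \<longleftrightarrow> i < n"
        using False by auto
      ultimately show ?thesis
        using track[OF i] unfolding on_track_def by presburger
    qed
  qed (use assms(1) n in simp_all)
  then show ?thesis
    using n by (simp add: next_token_def)
qed

text \<open>The robber moves last in a round. He replies as in the classical game to the joint move
  from \<open>b\<close> to the current positions, which become the starting positions of the next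
  round.\<close>

lemma evasive_robber_move:
  assumes N: "N \<ge> 2" and Cl: "set Cl \<subseteq> {1..N-1}" "i\<^sub>0 \<in> set Cl" and "length xs = N"
    and b: "\<not> classical_win E (map b Cl, xs ! (N - 1), True)"
    and track: "\<And>i. i \<in> {1..N-1} \<Longrightarrow> on_track E Cl i\<^sub>0 b N i (xs ! (i - 1))"
  shows "\<exists>r\<in>cnbhd E (xs ! (N - 1)). evasive E N Cl i\<^sub>0 (xs[N - 1 := r], 1)"
proof -
  define b' where "b' i = xs ! (i - 1)" for i
  have lt: "i < N" if "i \<in> {1..N-1}" for i
    using that N by auto
  have moved: "b' i \<in> cnbhd E (b i)" if i: "i \<in> set Cl" for i
  proof -
    have i': "i \<in> {1..N-1}"
      using Cl(1) i by blast
    show ?thesis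
      using track[OF i'] lt[OF i'] i by (simp add: on_track_def b'_def)
  qed
  then have "list_all2 (\<lambda>x y. y \<in> cnbhd E x) (map b Cl) (map b' Cl)"
    by (simp add: list_all2_conv_all_nth)
  then have "\<not> classical_win E (map b' Cl, xs ! (N - 1), False)"
    using b classical_win_cops_moveI[of E "map b Cl" "map b' Cl"] by blast
  then obtain r where r: "r \<in> cnbhd E (xs ! (N - 1))" "\<not> classical_win E (map b' Cl, r, True)"
    using classical_win_robber_moveI[of E "xs ! (N - 1)" "map b' Cl"] by blast
  have "evasive E N Cl i\<^sub>0 (xs[N - 1 := r], 1)"
  proof (rule evasiveI)
    show "\<not> classical_win E (map b' Cl, xs[N - 1 := r] ! (N - 1), True)"
      using r(2) N assms(4) by simp
    fix i
    assume i: "i \<in> {1..N-1}"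
    then have nth: "xs[N - 1 := r] ! (i - 1) = b' i"
      unfolding b'_def by (intro nth_list_update_neq) auto
    show "on_track E Cl i\<^sub>0 b' 1 i (xs[N - 1 := r] ! (i - 1))"
    proof (cases "i \<in> set Cl")
      case False
      \<comment> \<open>A follower now stands where its leader began the finished round, so the
        leader's new vertex is again one move ahead.\<close>
      then have "b' i = b i\<^sub>0"
        using track[OF i] lt[OF i] by (simp add: on_track_def b'_def)
      then show ?thesis
        unfolding nth using i False moved[OF Cl(2)] by (simp add: on_track_def)
    qed (use i in \<open>simp add: on_track_def nth[unfolded One_nat_def]\<close>)
  qed (use assms(4) N in simp_all)
  with r(1) show ?thesis
    by blast
qed

lemma evasive_not_pregame_win:
  assumes G: "fsc_graph V E" and N: "N \<ge> 2" and Cl: "set Cl \<subseteq> {1..N-1}" "i\<^sub>0 \<in> set Cl"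
    and "evasive E N Cl i\<^sub>0 s"
  shows "\<not> pregame_win E N (set Cl) s"
proof
  assume "pregame_win E N (set Cl) s"
  then show False
    using assms(5)
  proof (rule attractor_trap)
    fix s :: "'a pstate"
    assume s_evasive: "evasive E N Cl i\<^sub>0 s"
    then show "\<not> is_capture N s"
      by (rule evasive_not_capture[OF G Cl(2)])
    from s_evasive obtain xs n b where s: "s = (xs, n)" and len: "length xs = N"
      and n: "1 \<le> n" "n \<le> N" and b: "\<not> classical_win E (map b Cl, xs ! (N - 1), True)"
      and all_track: "\<forall>i\<in>{1..N-1}. on_track E Cl i\<^sub>0 b n i (xs ! (i - 1))"
      by (rule evasiveE)
    note track = bspec[OF all_track]
    show "evasive E N Cl i\<^sub>0 s'" if own: "snd s \<in> set Cl" and move: "pregame_move E N s s'" for s'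
    proof -
      obtain y where y: "y \<in> cnbhd E (xs ! (n - 1))" "s' = (xs[n - 1 := y], next_token N n)"
        using move unfolding pregame_move_def s by auto
      have nC: "n \<in> set Cl" "n \<in> {1..N-1}"
        using own Cl(1) s by auto
      then have "n < N" "on_track E Cl i\<^sub>0 b (Suc n) n y"
        using track[of n] y(1) by (auto simp: on_track_def)
      then show ?thesis
        unfolding y(2) using len n(1) b track by (intro evasive_cop_move)
    qed
    show "\<exists>s'. pregame_move E N s s' \<and> evasive E N Cl i\<^sub>0 s'" if "snd s \<notin> set Cl"
    proof (cases "n = N")
      case False
      \<comment> \<open>A cop outside the coalition is steered against it: it goes to the vertex
        where its leader began the round.\<close>
      then have "n < N" "b i\<^sub>0 \<in> cnbhd E (xs ! (n - 1))" "on_track E Cl i\<^sub>0 b (Suc n) n (b i\<^sub>0)"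
        using track[of n] n that s by (auto simp: on_track_def)
      moreover from this have "evasive E N Cl i\<^sub>0 (xs[n - 1 := b i\<^sub>0], next_token N n)"
        using len n(1) b track by (intro evasive_cop_move)
      ultimately show ?thesis
        unfolding pregame_move_def s by auto
    next
      case True
      then obtain r where "r \<in> cnbhd E (xs ! (N - 1))" "evasive E N Cl i\<^sub>0 (xs[N - 1 := r], 1)"
        using evasive_robber_move[OF N Cl len b] track by blast
      then show ?thesis
        unfolding pregame_move_def s using True by (auto simp: next_token_def)
    qed
  qed
qed

text \<open>Lets a coalition of at most \<open>m\<close> tokens be treated as exactly
  \<open>m\<close> classical cops, by repeating one of its members.\<close>

lemma ex_list_set_length:
  assumes "finite C" and "C \<noteq> {}" and "card C \<le> m"
  shows "\<exists>xs. set xs = C \<and> length xs = m"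
proof -
  obtain ys where ys: "set ys = C" "distinct ys"
    using finite_distinct_list[OF assms(1)] by blast
  obtain c where c: "c \<in> C"
    using assms(2) by blast
  let ?xs = "ys @ replicate (m - card C) c"
  have "set ?xs = C"
    using ys(1) c by (simp add: set_replicate_conv_if insert_absorb)
  moreover have "length ?xs = m"
    using distinct_card[OF ys(2)] ys(1) assms(3) by simp
  ultimately show ?thesis
    by blast
qed

text \<open>All cop tokens start on one vertex \<open>v\<close>, so every coalition yields the same
  classical placement \<open>replicate m v\<close>. Hence one state defeats all nonempty coalitions
  of at most \<open>m\<close> cops.\<close>

lemma ex_state_not_k_cops_capture:
  assumes G: "fsc_graph V E" and N: "N \<ge> 2" and m: "1 \<le> m"
    and lose: "\<not> classical_cops_win V E m"
  shows "\<exists>s\<in>S_nc V N. \<forall>k\<in>{1..m}. \<not> k_cops_capture E N s k"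
proof -
  obtain v where v: "v \<in> V"
    using fsc_graph_nonempty[OF G] by blast
  \<comment> \<open>Otherwise the \<open>m\<close> cops could walk to \<open>v\<close> from any
    placement and win from there.\<close>
  obtain r where r: "r \<in> V" "\<not> classical_win E (replicate m v, r, True)"
  proof (rule ccontr)
    assume "\<not> thesis"
    then have "classical_win E (replicate m v, r, True)" if "r \<in> V" for r
      using that \<open>\<And>r. r \<in> V \<Longrightarrow> _ \<Longrightarrow> thesis\<close> by blast
    then have "classical_win E (cs, r, True)" if "length cs = m" "set cs \<subseteq> V" "r \<in> V" for cs r
      using that v by (intro classical_win_any_placement[OF G, of "replicate m v" cs])
        (auto simp: set_replicate_conv_if)
    then have "classical_cops_win V E m"
      unfolding classical_cops_win_iff by blast
    with lose show False ..
  qed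
  have "r \<noteq> v"
    using not_classical_win_robber_far[OF r(2), of v] m by auto
  define xs where "xs = replicate (N - 1) v @ [r]"
  have xs: "length xs = N" "xs ! (N - 1) = r" "\<And>i. i \<in> {1..N-1} \<Longrightarrow> xs ! (i - 1) = v"
    using N by (auto simp: xs_def nth_append)
  have "(xs, 1) \<in> S_nc V N"
    using xs v r(1) N \<open>r \<noteq> v\<close> by (auto simp: S_nc_def is_capture_def pos_def xs_def)
  moreover have "\<not> k_cops_capture E N (xs, 1) k" if k: "k \<in> {1..m}" for k
  proof
    assume "k_cops_capture E N (xs, 1) k"
    then obtain C where C: "C \<subseteq> {1..N-1}" "card C = k" "pregame_win E N C (xs, 1)"
      unfolding k_cops_capture_iff by blast
    have "finite C" "C \<noteq> {}" "card C \<le> m"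
      using C k finite_subset[OF C(1)] by auto
    then obtain Cl where Cl: "set Cl = C" "length Cl = m"
      using ex_list_set_length by blast
    obtain i\<^sub>0 where i\<^sub>0: "i\<^sub>0 \<in> C"
      using \<open>C \<noteq> {}\<close> by blast
    have "evasive E N Cl i\<^sub>0 (xs, 1)"
    proof (rule evasiveI)
      show "\<not> classical_win E (map (\<lambda>_. v) Cl, xs ! (N - 1), True)"
        using r(2) unfolding xs(2) map_replicate_const Cl(2) .
      show "on_track E Cl i\<^sub>0 (\<lambda>_. v) 1 i (xs ! (i - 1))" if "i \<in> {1..N-1}" for i
        using xs(3)[OF that] that by (simp add: on_track_def)
    qed (use xs(1) N in simp_all)
    then show False
      using evasive_not_pregame_win[OF G N] C(1,3) Cl(1) i\<^sub>0 by blast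
  qed
  ultimately show ?thesis
    by blast
qed

section \<open>The maximum of the state cop numbers\<close>

lemma finite_S_nc:
  assumes "finite V"
  shows "finite (S_nc V N)"
proof (rule finite_subset)
  show "S_nc V N \<subseteq> {xs. set xs \<subseteq> V \<and> length xs = N} \<times> {1..N}"
    by (auto simp: S_nc_def)
  show "finite ({xs. set xs \<subseteq> V \<and> length xs = N} \<times> {1..N})"
    using finite_lists_length_eq[OF assms] by (intro finite_cartesian_product) simp_all
qed

text \<open>On a single vertex every state is a capture, and the maximum would range over the empty
  set.\<close>

lemma S_nc_nonempty:
  assumes "card V \<ge> 2" and "N \<ge> 2"
  shows "S_nc V N \<noteq> {}"
proof -
  obtain u v where "u \<in> V" "v \<in> V" "u \<noteq> v"
    using assms(1) card_le_Suc0_iff_eq[of V] by (metis card.infinite not_numeral_le_zero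
        not_less_eq_eq numeral_2_eq_2)
  then have "(replicate (N - 1) u @ [v], 1) \<in> S_nc V N"
    using assms(2) by (auto simp: S_nc_def is_capture_def pos_def nth_append)
  then show ?thesis
    by blast
qed

lemma state_cop_number_le:
  assumes "k_cops_capture E N s k" and "k \<in> {1..N-1}"
  shows "state_cop_number E N s \<le> enat k"
proof -
  have "(LEAST k. k \<in> {1..N-1} \<and> k_cops_capture E N s k) \<le> k"
    using assms by (intro Least_le conjI)
  then show ?thesis
    using assms by (auto simp only: state_cop_number_def enat_ord_simps split: if_split)
qed

lemma state_cop_number_cases:
  obtains "state_cop_number E N s = \<infinity>"
  | k where "state_cop_number E N s = enat k" "k \<in> {1..N-1}" "k_cops_capture E N s k"
proof (cases "\<exists>k\<in>{1..N-1}. k_cops_capture E N s k")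
  case True
  define k where "k = (LEAST k. k \<in> {1..N-1} \<and> k_cops_capture E N s k)"
  have "k \<in> {1..N-1} \<and> k_cops_capture E N s k"
    unfolding k_def by (rule LeastI_ex) (use True in blast)
  moreover have "state_cop_number E N s = enat k"
    unfolding state_cop_number_def k_def using True by (rule if_P)
  ultimately show thesis
    by (intro that(2)) blast+
next
  case False
  then have "state_cop_number E N s = \<infinity>"
    unfolding state_cop_number_def by (rule if_not_P)
  then show thesis
    by (rule that(1))
qed

lemma state_cop_number_gt:
  assumes "\<And>k. k \<in> {1..m} \<Longrightarrow> \<not> k_cops_capture E N s k"
  shows "state_cop_number E N s > enat m"
proof (cases rule: state_cop_number_cases[of E N s])
  case (2 k)
  then have "\<not> k \<le> m"
    using assms by auto
  then show ?thesis
    by (simp add: 2(1))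
qed simp

text \<open>Finite values never exceed \<open>N - 1\<close>.\<close>

lemma state_cop_number_gt_imp_infinity:
  assumes "state_cop_number E N s > enat (N - 1)"
  shows "state_cop_number E N s = \<infinity>"
  by (cases rule: state_cop_number_cases[of E N s]) (use assms in auto)

text \<open>For cop number at most \<open>N - 1\<close>, the simulation bounds every value from
  above, and the failure of one cop fewer gives a state attaining the bound. Otherwise the failure
  of \<open>N - 1\<close> cops gives a state of infinite value.\<close>

lemma Max_state_cop_number:
  assumes G: "fsc_graph V E" and N: "N \<ge> 2" and V: "card V \<ge> 2"
  shows "Max (state_cop_number E N ` S_nc V N) =
    (if cop_number V E \<le> N - 1 then enat (cop_number V E) else \<infinity>)"
proof -
  define K where "K = cop_number V E"
  have K_win: "classical_cops_win V E K"
    unfolding K_def cop_number_def using classical_cops_win_card[OF G] by (rule LeastI)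
  have K_least: "\<not> classical_cops_win V E m" if "m < K" for m
    using that not_less_Least unfolding K_def cop_number_def by blast
  have "K \<noteq> 0"
    using K_win not_classical_cops_win_0[OF G] by (cases K) simp_all
  have gt: "\<exists>s\<in>S_nc V N. state_cop_number E N s > enat m" if "m < K" for m
  proof (cases "m = 0")
    \<comment> \<open>For \<open>m = 0\<close> there are no coalitions to evade, and any noncapture
      state serves.\<close>
    case True
    obtain s where "s \<in> S_nc V N"
      using S_nc_nonempty[OF V N] by blast
    moreover have "state_cop_number E N s > enat m"
      by (rule state_cop_number_gt) (simp add: True)
    ultimately show ?thesis ..
  next
    case False
    then have "1 \<le> m"
      by simp
    from ex_state_not_k_cops_capture[OF G N this K_least[OF that]]
    obtain s where "s \<in> S_nc V N" "\<forall>k\<in>{1..m}. \<not> k_cops_capture E N s k"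
      by blast
    then show ?thesis
      using state_cop_number_gt by blast
  qed
  have fin: "finite (state_cop_number E N ` S_nc V N)"
    using finite_S_nc[OF fsc_graph_finite[OF G]] by (rule finite_imageI)
  show ?thesis
    unfolding K_def[symmetric]
  proof (cases "K \<le> N - 1")
    case True
    have le: "state_cop_number E N s \<le> enat K" if "s \<in> S_nc V N" for s
      using classical_cops_win_imp_k_cops_capture[OF G N True K_win that] True \<open>K \<noteq> 0\<close>
      by (intro state_cop_number_le) auto
    obtain s where s: "s \<in> S_nc V N" "state_cop_number E N s > enat (K - 1)"
      using gt[of "K - 1"] \<open>K \<noteq> 0\<close> by auto
    have "enat K \<le> state_cop_number E N s"
      using ileI1[OF s(2)] \<open>K \<noteq> 0\<close> by (simp add: eSuc_enat)
    then have "state_cop_number E N s = enat K"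
      using le s(1) by (simp add: order_antisym)
    then show "Max (state_cop_number E N ` S_nc V N) = (if K \<le> N - 1 then enat K else \<infinity>)"
      using True le s(1) fin by (auto intro!: Max_eqI image_eqI)
  next
    case False
    then have "N - 1 < K"
      by simp
    then obtain s where s: "s \<in> S_nc V N" "state_cop_number E N s = \<infinity>"
      using gt state_cop_number_gt_imp_infinity by blast
    then show "Max (state_cop_number E N ` S_nc V N) = (if K \<le> N - 1 then enat K else \<infinity>)"
      using False fin by (auto intro!: Max_eqI image_eqI)
  qed
qed

text \<open>Both parts are read off the closed form of the maximum: \<open>enat\<close> is injective
  and never infinite.\<close>

theorem theoremA1:
  fixes V :: "'a set" and E :: "'a \<Rightarrow> 'a \<Rightarrow> bool" and N :: nat
  assumes "fsc_graph V E" and "N \<ge> 2" and "card V \<ge> 2"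
  shows "(\<forall>K \<le> N - 1. cop_number V E = K \<longleftrightarrow>
            Max (state_cop_number E N ` S_nc V N) = enat K)
       \<and> (cop_number V E > N - 1 \<longleftrightarrow>
            Max (state_cop_number E N ` S_nc V N) = \<infinity>)"
  unfolding Max_state_cop_number[OF assms] by simp

end
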